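(* Fix a real number $p>0$ and an integer $w\ge 0$. Consider lattice walks in the plane with steps $(1,1)$, $(1,-1)$, $(p,2)$, $(p,-2)$ that start at $(0,0)$, end on the $x$-axis, and never leave the strip $0\le y\le w$ (the empty walk is included). Give each such walk the weight $z^{L/2}$, where $L$ is the total horizontal distance it travels (so a step $(1,\pm1)$ has weight $z^{1/2}$ and a step $(p,\pm 2)$ has weight $z^{p/2}$), and let $X_w$ be the sum of the weights of all such walks. Then for every $w\ge 4$, $$X_w = 1 - z^{p/2}X_w + (z+z^{p/2})X_wX_{w-1} + (z^{1+p/2}+z^{p})X_wX_{w-1}X_{w-2} - (z^{3p/2}+z^{2p})X_wX_{w-1}X_{w-2}X_{w-3} + z^{5p/2}X_wX_{w-1}X_{w-2}X_{w-3}X_{w-4}.$$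
   Context: $X_w$ is a formal generating series in the weights $z^{L/2}$ (a formal sum of real powers of $z$ with nonnegative integer coefficients, each coefficient finite). *)

theory Defs
  imports Complex_Main
begin

section \<open>Formal series in real powers of an indeterminate\<close>

text \<open>
  A series is a formal sum of terms \<open>c\<^sub>e z\<^sup>e\<close> with real exponents \<open>e\<close> and integer coefficients, such
  that only finitely many exponents below any given bound occur. This support condition makes every
  coefficient of a Cauchy product a finite sum. Coefficients are integers rather than naturals so
  that series can be subtracted.
\<close>

definition left_finite :: "(real \<Rightarrow> int) \<Rightarrow> bool" where
  "left_finite f \<longleftrightarrow> (\<forall>B. finite {e. e \<le> B \<and> f e \<noteq> 0})"

typedef rseries = "{f. left_finite f}"
  morphisms coeff Abs_rseries
  by (rule exI[of _ "\<lambda>_. 0"]) (simp add: left_finite_def)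

setup_lifting type_definition_rseries

lemma left_finite_subset:
  assumes "left_finite f" "left_finite g" "\<And>e. h e \<noteq> 0 \<Longrightarrow> f e \<noteq> 0 \<or> g e \<noteq> 0"
  shows "left_finite h"
  unfolding left_finite_def
proof
  fix B
  have "finite ({e. e \<le> B \<and> f e \<noteq> 0} \<union> {e. e \<le> B \<and> g e \<noteq> 0})"
    using assms(1,2) by (simp add: left_finite_def)
  then show "finite {e. e \<le> B \<and> h e \<noteq> 0}"
    by (rule finite_subset[rotated]) (use assms(3) in blast)
qed

lemma left_finite_lower_bound:
  assumes "left_finite f"
  obtains m where "\<And>e. f e \<noteq> 0 \<Longrightarrow> m \<le> e"
proof -
  let ?S = "{e. e \<le> 0 \<and> f e \<noteq> 0}"
  have fin: "finite (insert 0 ?S)" using assms by (simp add: left_finite_def)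
  have "Min (insert 0 ?S) \<le> e" if "f e \<noteq> 0" for e
  proof (cases "e \<le> 0")
    case True
    then show ?thesis using fin that by (intro Min_le) auto
  next
    case False
    have "Min (insert 0 ?S) \<le> 0" using fin by (intro Min_le) auto
    then show ?thesis using False by linarith
  qed
  then show ?thesis using that by blast
qed

definition conv :: "(real \<Rightarrow> int) \<Rightarrow> (real \<Rightarrow> int) \<Rightarrow> real \<Rightarrow> int" where
  "conv f g e = (\<Sum>a | f a \<noteq> 0 \<and> g (e - a) \<noteq> 0. f a * g (e - a))"

lemma finite_conv_support:
  assumes "left_finite f" "left_finite g"
  shows "finite {a. f a \<noteq> 0 \<and> g (e - a) \<noteq> 0}"
proof -
  obtain m where m: "\<And>e. g e \<noteq> 0 \<Longrightarrow> m \<le> e" using left_finite_lower_bound[OF assms(2)] by blast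
  have "{a. f a \<noteq> 0 \<and> g (e - a) \<noteq> 0} \<subseteq> {a. a \<le> e - m \<and> f a \<noteq> 0}"
    using m by force
  then show ?thesis using assms(1) finite_subset unfolding left_finite_def by blast
qed

lemma conv_eq_sum:
  assumes "finite F" "\<And>a. f a \<noteq> 0 \<Longrightarrow> g (e - a) \<noteq> 0 \<Longrightarrow> a \<in> F"
  shows "conv f g e = (\<Sum>a\<in>F. f a * g (e - a))"
  unfolding conv_def by (rule sum.mono_neutral_left) (use assms in auto)

lemma conv_nonzeroD:
  assumes "conv f g e \<noteq> 0"
  obtains a where "f a \<noteq> 0" "g (e - a) \<noteq> 0"
proof -
  have "{a. f a \<noteq> 0 \<and> g (e - a) \<noteq> 0} \<noteq> {}"
    using assms unfolding conv_def by (metis sum.empty)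
  then show ?thesis using that by blast
qed

lemma left_finite_conv:
  assumes "left_finite f" "left_finite g"
  shows "left_finite (conv f g)"
  unfolding left_finite_def
proof
  fix B
  obtain m where m: "\<And>e. f e \<noteq> 0 \<Longrightarrow> m \<le> e" using left_finite_lower_bound[OF assms(1)] by blast
  obtain n where n: "\<And>e. g e \<noteq> 0 \<Longrightarrow> n \<le> e" using left_finite_lower_bound[OF assms(2)] by blast
  let ?F = "{e. e \<le> B - n \<and> f e \<noteq> 0}" and ?G = "{e. e \<le> B - m \<and> g e \<noteq> 0}"
  have "{e. e \<le> B \<and> conv f g e \<noteq> 0} \<subseteq> (\<lambda>(a, b). a + b) ` (?F \<times> ?G)"
  proof
    fix e assume "e \<in> {e. e \<le> B \<and> conv f g e \<noteq> 0}"
    then have e: "e \<le> B" "conv f g e \<noteq> 0" by auto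
    obtain a where a: "f a \<noteq> 0" "g (e - a) \<noteq> 0" using conv_nonzeroD[OF e(2)] by blast
    have "(a, e - a) \<in> ?F \<times> ?G" using a m[OF a(1)] n[OF a(2)] e(1) by auto
    then show "e \<in> (\<lambda>(a, b). a + b) ` (?F \<times> ?G)" by (rule rev_image_eqI) simp
  qed
  moreover have "finite (?F \<times> ?G)" using assms by (simp add: left_finite_def)
  ultimately show "finite {e. e \<le> B \<and> conv f g e \<noteq> 0}" by (meson finite_surj)
qed

lemma conv_commute: "conv f g = conv g f"
proof
  fix e
  show "conv f g e = conv g f e"
    unfolding conv_def
    by (rule sum.reindex_bij_witness[of _ "\<lambda>a. e - a" "\<lambda>a. e - a"]) (auto simp: mult.commute)
qed

lemma conv_assoc:
  assumes f: "left_finite f" and g: "left_finite g" and h: "left_finite h"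
  shows "conv (conv f g) h = conv f (conv g h)"
proof
  fix e
  obtain l where l: "\<And>e. f e \<noteq> 0 \<Longrightarrow> l \<le> e" using left_finite_lower_bound[OF f] by blast
  obtain m where m: "\<And>e. g e \<noteq> 0 \<Longrightarrow> m \<le> e" using left_finite_lower_bound[OF g] by blast
  obtain n where n: "\<And>e. h e \<noteq> 0 \<Longrightarrow> n \<le> e" using left_finite_lower_bound[OF h] by blast
  define F where "F = {a. a \<le> e - m - n \<and> f a \<noteq> 0}"
  define H where "H = {c. c \<le> e - l - m \<and> h c \<noteq> 0}"
  have fin: "finite F" "finite H" using f h by (auto simp: F_def H_def left_finite_def)
  have "conv (conv f g) h e = conv h (conv f g) e" by (simp only: conv_commute)
  also have "\<dots> = (\<Sum>c\<in>H. h c * conv f g (e - c))"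
  proof (rule conv_eq_sum[OF fin(2)])
    fix c assume "h c \<noteq> 0" "conv f g (e - c) \<noteq> 0"
    then show "c \<in> H" unfolding H_def using l m by (force elim!: conv_nonzeroD)
  qed
  also have "\<dots> = (\<Sum>c\<in>H. h c * (\<Sum>a\<in>F. f a * g (e - c - a)))"
  proof (rule sum.cong[OF refl])
    fix c assume c: "c \<in> H"
    have "conv f g (e - c) = (\<Sum>a\<in>F. f a * g (e - c - a))"
      by (rule conv_eq_sum[OF fin(1)]) (use c m n in \<open>force simp: F_def H_def\<close>)
    then show "h c * conv f g (e - c) = h c * (\<Sum>a\<in>F. f a * g (e - c - a))" by simp
  qed
  also have "\<dots> = (\<Sum>a\<in>F. f a * (\<Sum>c\<in>H. h c * g (e - a - c)))"
    unfolding sum_distrib_left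
    by (subst sum.swap) (simp add: algebra_simps)
  also have "\<dots> = (\<Sum>a\<in>F. f a * conv h g (e - a))"
  proof (rule sum.cong[OF refl])
    fix a assume a: "a \<in> F"
    have "conv h g (e - a) = (\<Sum>c\<in>H. h c * g (e - a - c))"
      by (rule conv_eq_sum[OF fin(2)]) (use a l m in \<open>force simp: F_def H_def\<close>)
    then show "f a * (\<Sum>c\<in>H. h c * g (e - a - c)) = f a * conv h g (e - a)" by simp
  qed
  also have "\<dots> = (\<Sum>a\<in>F. f a * conv g h (e - a))" by (simp only: conv_commute)
  also have "\<dots> = conv f (conv g h) e"
  proof (rule conv_eq_sum[OF fin(1), symmetric])
    fix a assume "f a \<noteq> 0" "conv g h (e - a) \<noteq> 0"
    then show "a \<in> F" unfolding F_def using m n by (force elim!: conv_nonzeroD)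
  qed
  finally show "conv (conv f g) h e = conv f (conv g h) e" .
qed

lemma conv_distrib:
  assumes "left_finite f" "left_finite g" "left_finite h"
  shows "conv (\<lambda>e. f e + g e) h = (\<lambda>e. conv f h e + conv g h e)"
proof
  fix e
  let ?F = "{a. f a \<noteq> 0 \<and> h (e - a) \<noteq> 0} \<union> {a. g a \<noteq> 0 \<and> h (e - a) \<noteq> 0}"
  have fin: "finite ?F" using assms by (simp add: finite_conv_support)
  have "conv (\<lambda>e. f e + g e) h e = (\<Sum>a\<in>?F. (f a + g a) * h (e - a))"
    by (rule conv_eq_sum[OF fin]) auto
  moreover have "conv f h e = (\<Sum>a\<in>?F. f a * h (e - a))" by (rule conv_eq_sum[OF fin]) auto
  moreover have "conv g h e = (\<Sum>a\<in>?F. g a * h (e - a))" by (rule conv_eq_sum[OF fin]) auto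
  ultimately show "conv (\<lambda>e. f e + g e) h e = conv f h e + conv g h e"
    by (simp add: distrib_right sum.distrib)
qed

lemma left_finite_single: "left_finite (\<lambda>e. if e = a then c else 0)"
  unfolding left_finite_def by (auto intro: finite_subset[of _ "{a}"])

lift_definition zpow :: "real \<Rightarrow> rseries" is "\<lambda>a e. if e = a then 1 else 0"
  by (rule left_finite_single)

instantiation rseries :: comm_ring_1
begin

lift_definition zero_rseries :: rseries is "\<lambda>_. 0"
  by (simp add: left_finite_def)

lift_definition one_rseries :: rseries is "\<lambda>e. if e = 0 then 1 else 0"
  by (rule left_finite_single)

lift_definition plus_rseries :: "rseries \<Rightarrow> rseries \<Rightarrow> rseries" is "\<lambda>f g e. f e + g e"
  by (erule (1) left_finite_subset) auto

lift_definition minus_rseries :: "rseries \<Rightarrow> rseries \<Rightarrow> rseries" is "\<lambda>f g e. f e - g e"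
  by (erule (1) left_finite_subset) auto

lift_definition uminus_rseries :: "rseries \<Rightarrow> rseries" is "\<lambda>f e. - f e"
  by (simp add: left_finite_def)

lift_definition times_rseries :: "rseries \<Rightarrow> rseries \<Rightarrow> rseries" is conv
  by (rule left_finite_conv)

instance
proof
  fix a b c :: rseries
  show "a + b + c = a + (b + c)" by transfer (simp add: add.assoc)
  show "a + b = b + a" by transfer (simp add: add.commute)
  show "0 + a = a" by transfer simp
  show "- a + a = 0" by transfer simp
  show "a - b = a + - b" by transfer simp
  show "a * b * c = a * (b * c)" by transfer (rule conv_assoc)
  show "a * b = b * a" by transfer (rule conv_commute)
  show "1 * a = a"
  proof transfer
    fix f :: "real \<Rightarrow> int"
    show "conv (\<lambda>e. if e = 0 then 1 else 0) f = f"
    proof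
      fix e
      show "conv (\<lambda>e. if e = 0 then 1 else 0) f e = f e"
        by (subst conv_eq_sum[of "{0}"]) (auto split: if_splits)
    qed
  qed
  show "(a + b) * c = a * c + b * c" by transfer (rule conv_distrib)
  show "(0::rseries) \<noteq> 1" by transfer (metis zero_neq_one)
qed

end

lemma zpow_0: "zpow 0 = 1"
  by transfer (rule refl)

lemma zpow_add: "zpow (a + b) = zpow a * zpow b"
proof transfer
  fix a b :: real
  show "(\<lambda>e. if e = a + b then 1 else 0) =
    conv (\<lambda>e. if e = a then 1 else 0) (\<lambda>e. if e = b then 1 else 0)"
  proof
    fix e
    show "(if e = a + b then 1 else 0) =
      conv (\<lambda>e. if e = a then 1 else 0) (\<lambda>e. if e = b then 1 else 0) e"
      by (subst conv_eq_sum[of "{a}"]) (auto split: if_splits)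
  qed
qed

section \<open>Walks in a strip\<close>

text \<open>A step is a pair of its horizontal and its vertical displacement; a walk starting at the
  origin is the list of its steps.\<close>

definition steps :: "real \<Rightarrow> (real \<times> int) set" where
  "steps p = {(1, 1), (1, -1), (p, 2), (p, -2)}"

definition width :: "(real \<times> int) list \<Rightarrow> real" where
  "width ws = (\<Sum>s\<leftarrow>ws. fst s)"

definition height :: "(real \<times> int) list \<Rightarrow> int" where
  "height ws = (\<Sum>s\<leftarrow>ws. snd s)"

definition strip_walks :: "real \<Rightarrow> nat \<Rightarrow> (real \<times> int) list set" where
  "strip_walks p w = {ws. set ws \<subseteq> steps p
     \<and> (\<forall>k\<le>length ws. 0 \<le> height (take k ws) \<and> height (take k ws) \<le> int w)
     \<and> height ws = 0}"

text \<open>The coefficient of \<open>z\<^sup>e\<close> is the number of walks of weight \<open>z\<^sup>e\<close>. That these sets of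
  walks are finite and that the support condition holds requires \<open>p > 0\<close>; see
  \<open>finite_strip_walks\<close> and \<open>coeff_X\<close> below.\<close>

definition X :: "real \<Rightarrow> nat \<Rightarrow> rseries" where
  "X p w = Abs_rseries (\<lambda>e. int (card {ws \<in> strip_walks p w. width ws / 2 = e}))"

lemma width_ge_length:
  assumes "set ws \<subseteq> steps p"
  shows "min 1 p * real (length ws) \<le> width ws"
  using assms by (induction ws) (auto simp: width_def steps_def algebra_simps)

lemma finite_strip_walks:
  assumes "p > 0"
  shows "finite {ws \<in> strip_walks p w. width ws / 2 \<le> B}"
proof (rule finite_subset)
  show "{ws \<in> strip_walks p w. width ws / 2 \<le> B}
    \<subseteq> {ws. set ws \<subseteq> steps p \<and> length ws \<le> nat \<lceil>2 * B / min 1 p\<rceil>}"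
  proof clarify
    fix ws assume ws: "ws \<in> strip_walks p w" "width ws / 2 \<le> B"
    then have sub: "set ws \<subseteq> steps p" by (simp add: strip_walks_def)
    have "real (length ws) * min 1 p \<le> 2 * B"
      using width_ge_length[OF sub] ws(2) by (simp add: mult.commute)
    then have "real (length ws) \<le> 2 * B / min 1 p" using assms by (simp add: pos_le_divide_eq)
    then have "length ws \<le> nat \<lceil>2 * B / min 1 p\<rceil>" by linarith
    with sub show "set ws \<subseteq> steps p \<and> length ws \<le> nat \<lceil>2 * B / min 1 p\<rceil>" ..
  qed
  show "finite {ws. set ws \<subseteq> steps p \<and> length ws \<le> nat \<lceil>2 * B / min 1 p\<rceil>}"
    by (rule finite_lists_length_le) (simp add: steps_def)
qed

lemma coeff_X:
  assumes "p > 0"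
  shows "coeff (X p w) e = int (card {ws \<in> strip_walks p w. width ws / 2 = e})"
proof -
  let ?f = "\<lambda>e. int (card {ws \<in> strip_walks p w. width ws / 2 = e})"
  have "left_finite ?f"
    unfolding left_finite_def
  proof
    fix B
    have "{e. e \<le> B \<and> ?f e \<noteq> 0} \<subseteq> (\<lambda>ws. width ws / 2) ` {ws \<in> strip_walks p w. width ws / 2 \<le> B}"
    proof
      fix e assume "e \<in> {e. e \<le> B \<and> ?f e \<noteq> 0}"
      then have "e \<le> B" and "?f e \<noteq> 0" by auto
      then obtain ws where "ws \<in> strip_walks p w" "width ws / 2 = e"
        by (metis (mono_tags, lifting) card.empty empty_Collect_eq of_nat_0)
      with \<open>e \<le> B\<close> show "e \<in> (\<lambda>ws. width ws / 2) ` {ws \<in> strip_walks p w. width ws / 2 \<le> B}"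
        by blast
    qed
    then show "finite {e. e \<le> B \<and> ?f e \<noteq> 0}"
      using finite_strip_walks[OF assms] by (meson finite_surj)
  qed
  then show ?thesis unfolding X_def by (subst Abs_rseries_inverse) auto
qed

end

theory Submission
  imports Defs
begin

text \<open>
  Let \<open>x\<^sub>w\<close>, \<open>y\<^sub>w\<close>, \<open>t\<^sub>w\<close> count the walks in the strip of width \<open>w\<close> from \<open>0\<close> to \<open>0\<close>, from \<open>0\<close> to \<open>1\<close>
  and from \<open>1\<close> to \<open>1\<close>, and put \<open>a = z\<^sup>1\<^sup>/\<^sup>2\<close>, \<open>b = z\<^sup>p\<^sup>/\<^sup>2\<close>. Cutting a walk at its first visit to
  level \<open>0\<close> expresses these series through those of the strip of width \<open>w - 1\<close>:
  \<open>x\<^sub>w = 1 + x\<^sub>w (a\<^sup>2 x\<^sub>w\<^sub>-\<^sub>1 + 2 a b y\<^sub>w\<^sub>-\<^sub>1 + b\<^sup>2 t\<^sub>w\<^sub>-\<^sub>1)\<close>, \<open>y\<^sub>w = x\<^sub>w (a x\<^sub>w\<^sub>-\<^sub>1 + b y\<^sub>w\<^sub>-\<^sub>1)\<close> and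
  \<open>t\<^sub>w = x\<^sub>w\<^sub>-\<^sub>1 + y\<^sub>w (a x\<^sub>w\<^sub>-\<^sub>1 + b y\<^sub>w\<^sub>-\<^sub>1)\<close>. These imply
  \<open>t\<^sub>w = x\<^sub>w x\<^sub>w\<^sub>-\<^sub>1 (1 - b\<^sup>2 x\<^sub>w\<^sub>-\<^sub>2)\<close>, and eliminating \<open>y\<close> between the first relation at \<open>w\<close> and
  at \<open>w - 1\<close> gives the theorem. The cutting identities are obtained from the linear system of
  first-step equations, whose solution is unique because every step has positive weight.
\<close>

section \<open>Walks between arbitrary levels\<close>

text \<open>The prefix \<open>k = 0\<close> already confines the starting level to the strip, so
  \<open>G\<close> vanishes as soon as either endpoint lies outside; boundary cases of the later
  equations rely on these zeros.\<close>

definition walks :: "real \<Rightarrow> nat \<Rightarrow> int \<Rightarrow> int \<Rightarrow> (real \<times> int) list set" where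
  "walks p w i j = {ws. set ws \<subseteq> steps p
     \<and> (\<forall>k\<le>length ws. 0 \<le> i + height (take k ws) \<and> i + height (take k ws) \<le> int w)
     \<and> i + height ws = j}"

definition G :: "real \<Rightarrow> nat \<Rightarrow> int \<Rightarrow> int \<Rightarrow> rseries" where
  "G p w i j = Abs_rseries (\<lambda>e. int (card {ws \<in> walks p w i j. width ws / 2 = e}))"

lemma X_eq_G: "X p w = G p w 0 0"
  by (simp add: X_def G_def strip_walks_def walks_def)

lemma Nil_in_walks: "[] \<in> walks p w i j \<longleftrightarrow> i \<in> {0..int w} \<and> i = j"
  by (auto simp: walks_def height_def)

lemma Cons_in_walks:
  "s # ws \<in> walks p w i j \<longleftrightarrow>
     s \<in> steps p \<and> i \<in> {0..int w} \<and> ws \<in> walks p w (i + snd s) j"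
proof -
  have "(\<forall>k\<le>Suc n. Q k) \<longleftrightarrow> Q 0 \<and> (\<forall>k\<le>n. Q (Suc k))" for n and Q :: "nat \<Rightarrow> bool"
    by (metis Suc_le_mono not0_implies_Suc zero_le)
  then show ?thesis
    by (auto simp: walks_def height_def add.assoc)
qed

lemma finite_walks_width_le:
  assumes "p > 0"
  shows "finite {ws \<in> walks p w i j. width ws / 2 \<le> B}"
proof (rule finite_subset)
  show "{ws \<in> walks p w i j. width ws / 2 \<le> B}
    \<subseteq> {ws. set ws \<subseteq> steps p \<and> length ws \<le> nat \<lceil>2 * B / min 1 p\<rceil>}"
  proof clarify
    fix ws assume ws: "ws \<in> walks p w i j" "width ws / 2 \<le> B"
    then have sub: "set ws \<subseteq> steps p" by (simp add: walks_def)
    have "real (length ws) \<le> 2 * B / min 1 p"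
      using width_ge_length[OF sub] ws(2) assms by (simp add: pos_le_divide_eq mult.commute)
    with sub show "set ws \<subseteq> steps p \<and> length ws \<le> nat \<lceil>2 * B / min 1 p\<rceil>" by linarith
  qed
  show "finite {ws. set ws \<subseteq> steps p \<and> length ws \<le> nat \<lceil>2 * B / min 1 p\<rceil>}"
    by (rule finite_lists_length_le) (simp add: steps_def)
qed

lemma finite_walks_width_eq:
  assumes "p > 0"
  shows "finite {ws \<in> walks p w i j. width ws / 2 = e}"
  by (rule finite_subset[OF _ finite_walks_width_le[OF assms, of w i j e]]) auto

lemma coeff_G:
  assumes "p > 0"
  shows "coeff (G p w i j) e = int (card {ws \<in> walks p w i j. width ws / 2 = e})"
proof -
  let ?f = "\<lambda>e. int (card {ws \<in> walks p w i j. width ws / 2 = e})"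
  have "left_finite ?f"
    unfolding left_finite_def
  proof
    fix B
    have "e \<in> (\<lambda>ws. width ws / 2) ` {ws \<in> walks p w i j. width ws / 2 \<le> B}"
      if "e \<le> B" "?f e \<noteq> 0" for e
    proof -
      have "{ws \<in> walks p w i j. width ws / 2 = e} \<noteq> {}"
        using that(2) by (metis card.empty of_nat_0)
      with that(1) show ?thesis by blast
    qed
    then show "finite {e. e \<le> B \<and> ?f e \<noteq> 0}"
      by (intro finite_surj[OF finite_walks_width_le[OF assms, of w i j B]] subsetI) blast
  qed
  then show ?thesis unfolding G_def by (subst Abs_rseries_inverse) auto
qed

section \<open>Coefficients and the first-step equations\<close>

lemma coeff_zpow_times: "coeff (zpow a * f) e = coeff f (e - a)"
proof transfer
  fix a e and f :: "real \<Rightarrow> int"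
  show "conv (\<lambda>e. if e = a then 1 else 0) f e = f (e - a)"
    by (subst conv_eq_sum[of "{a}"]) (auto split: if_splits)
qed

lemma rseries_eqI: "(\<And>e. coeff f e = coeff g e) \<Longrightarrow> f = g"
  by (metis coeff_inject ext)

lemma coeff_simps:
  "coeff 0 e = 0"
  "coeff 1 e = (if e = 0 then 1 else 0)"
  "coeff (f + g) e = coeff f e + coeff g e"
  by (transfer, simp)+

lemma coeff_sum: "coeff (sum f A) e = (\<Sum>s\<in>A. coeff (f s) e)"
  by (induction A rule: infinite_finite_induct) (simp_all add: coeff_simps)

lemma G_outside:
  assumes "i \<notin> {0..int w} \<or> j \<notin> {0..int w}"
  shows "G p w i j = 0"
proof -
  have "walks p w i j = {}"
    using assms unfolding walks_def by (force simp: height_def)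
  then show ?thesis by (simp add: G_def zero_rseries_def)
qed

lemma finite_steps: "finite (steps p)"
  by (simp add: steps_def)

lemma G_first_step:
  assumes p: "p > 0" and i: "i \<in> {0..int w}"
  shows "G p w i j = (if i = j then 1 else 0)
    + (\<Sum>s\<in>steps p. zpow (fst s / 2) * G p w (i + snd s) j)"
proof -
  have "coeff (G p w i j) e = coeff ((if i = j then 1 else 0)
    + (\<Sum>s\<in>steps p. zpow (fst s / 2) * G p w (i + snd s) j)) e" for e
  proof -
    define A where "A s = {ws \<in> walks p w (i + snd s) j. width ws / 2 = e - fst s / 2}" for s
    define N where "N = (if i = j \<and> e = 0 then {[] :: (real \<times> int) list} else {})"
    define C where "C = (\<Union>s\<in>steps p. Cons s ` A s)"
    have fin: "finite (A s)" for s
      unfolding A_def by (rule finite_walks_width_eq[OF p])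
    have split: "{ws \<in> walks p w i j. width ws / 2 = e} = N \<union> C"
    proof (rule set_eqI)
      fix ws
      show "ws \<in> {ws \<in> walks p w i j. width ws / 2 = e} \<longleftrightarrow> ws \<in> N \<union> C"
      proof (cases ws)
        case Nil
        then show ?thesis using i by (auto simp: N_def C_def Nil_in_walks width_def)
      next
        case (Cons s ws')
        have "width ws / 2 = e \<longleftrightarrow> width ws' / 2 = e - fst s / 2"
          using Cons by (auto simp: width_def field_simps)
        then show ?thesis using i Cons by (auto simp: N_def C_def A_def Cons_in_walks)
      qed
    qed
    have "card C = (\<Sum>s\<in>steps p. card (Cons s ` A s))"
      unfolding C_def by (rule card_UN_disjoint) (use fin finite_steps in auto)
    also have "\<dots> = (\<Sum>s\<in>steps p. card (A s))"
      by (intro sum.cong refl card_image) simp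
    finally have "card C = (\<Sum>s\<in>steps p. card (A s))" .
    moreover have "card (N \<union> C) = card N + card C"
      by (rule card_Un_disjoint) (use fin finite_steps in \<open>auto simp: N_def C_def\<close>)
    moreover have "int (card N) = coeff (if i = j then 1 else 0) e"
      by (simp add: N_def coeff_simps)
    moreover have "coeff (G p w (i + snd s) j) (e - fst s / 2) = int (card (A s))" for s
      by (simp only: coeff_G[OF p] A_def)
    ultimately show ?thesis
      by (simp only: coeff_G[OF p, of w i j] split coeff_simps(3) coeff_sum coeff_zpow_times
          of_nat_add of_nat_sum)
  qed
  then show ?thesis by (rule rseries_eqI)
qed

lemma first_step_system_unique:
  fixes f :: "int \<Rightarrow> rseries"
  assumes p: "p > 0"
    and out: "\<And>i. i \<notin> {0..int w} \<Longrightarrow> f i = 0"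
    and step: "\<And>i. i \<in> {0..int w} \<Longrightarrow> f i = (\<Sum>s\<in>steps p. zpow (fst s / 2) * f (i + snd s))"
  shows "f i = 0"
proof -
  define \<mu> where "\<mu> = min 1 p / 2"
  have \<mu>: "\<mu> > 0" and step_ge: "s \<in> steps p \<Longrightarrow> \<mu> \<le> fst s / 2" for s
    using p by (auto simp: \<mu>_def steps_def)
  have "\<exists>m. \<forall>e. coeff (f i) e \<noteq> 0 \<longrightarrow> m \<le> e" for i
    using coeff[of "f i"] left_finite_lower_bound by (metis mem_Collect_eq)
  then obtain m where m: "\<And>i e. coeff (f i) e \<noteq> 0 \<Longrightarrow> m i \<le> e" by metis
  \<comment> \<open>Only levels in the strip carry a nonzero series, so one bound \<open>M\<close>
    serves all of them. Each substitution of the system raises it by at least \<open>\<mu>\<close>,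
    the least exponent of a step.\<close>
  define M where "M = Min (m ` {0..int w})"
  have bound: "M + real n * \<mu> \<le> e" if "coeff (f i) e \<noteq> 0" for n i e
    using that
  proof (induction n arbitrary: i e)
    case 0
    then have "i \<in> {0..int w}" using out[of i] by (metis coeff_simps(1))
    then have "M \<le> m i" unfolding M_def by (intro Min_le) auto
    with m[OF 0] show ?case by simp
  next
    case (Suc n)
    then have "i \<in> {0..int w}" using out[of i] by (metis coeff_simps(1))
    from step[OF this] Suc.prems
    have "(\<Sum>s\<in>steps p. coeff (f (i + snd s)) (e - fst s / 2)) \<noteq> 0"
      by (simp add: coeff_sum coeff_zpow_times)
    then obtain s where s: "s \<in> steps p" "coeff (f (i + snd s)) (e - fst s / 2) \<noteq> 0"
      by (meson sum.neutral)
    from Suc.IH[OF s(2)] step_ge[OF s(1)] show ?case by (simp add: algebra_simps)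
  qed
  have "coeff (f i) e = coeff 0 e" for e
  proof (rule ccontr)
    assume "coeff (f i) e \<noteq> coeff 0 e"
    then have "coeff (f i) e \<noteq> 0" by (simp add: coeff_simps)
    then have "M + real n * \<mu> \<le> e" for n by (rule bound)
    moreover obtain n where "e - M < real n * \<mu>"
      using reals_Archimedean3[OF \<mu>] by blast
    ultimately show False by (smt (verit))
  qed
  then show ?thesis by (rule rseries_eqI)
qed

section \<open>Cutting at level zero\<close>

lemma sum_steps:
  "(\<Sum>s\<in>steps p. zpow (fst s / 2) * f (i + snd s)) =
     zpow (1 / 2) * (f (i + 1) + f (i - 1)) + zpow (p / 2) * (f (i + 2) + f (i - 2))"
  by (simp add: steps_def algebra_simps)

lemma G_rec:
  assumes "p > 0" "i \<in> {0..int w}"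
  shows "G p w i j = (if i = j then 1 else 0)
    + zpow (1 / 2) * (G p w (i + 1) j + G p w (i - 1) j)
    + zpow (p / 2) * (G p w (i + 2) j + G p w (i - 2) j)"
  unfolding G_first_step[OF assms] sum_steps[where f = "\<lambda>i. G p w i j"] by (simp add: add.assoc)

text \<open>The first summand counts the walks that avoid level \<open>0\<close>; the others are cut at their first
  visit to level \<open>0\<close>, which is reached by a step from level \<open>1\<close> or \<open>2\<close>.\<close>

lemma G_cut:
  assumes p: "p > 0" and i: "i \<ge> 0"
  shows "G p (Suc w) (i + 1) j = G p w i (j - 1)
    + G p (Suc w) 0 j * (zpow (1 / 2) * G p w i 0 + zpow (p / 2) * G p w i 1)"
proof -
  let ?a = "zpow (1 / 2)" and ?b = "zpow (p / 2)"
  define D where "D i = G p (Suc w) (i + 1) j - G p w i (j - 1)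
    - G p (Suc w) 0 j * (?a * G p w i 0 + ?b * G p w i 1)" for i
  \<comment> \<open>The truncation matters at \<open>i = -1\<close>, where \<open>D\<close> equals
    \<open>G p (Suc w) 0 j\<close> rather than zero.\<close>
  define f where "f i = (if i < 0 then 0 else D i)" for i
  have "f i = 0"
  proof (rule first_step_system_unique[OF p, of w])
    fix i assume "i \<notin> {0..int w}"
    then show "f i = 0" by (auto simp: f_def D_def G_outside)
  next
    fix i assume i: "i \<in> {0..int w}"
    have neg: "G p w k l = 0" "G p (Suc w) k l = 0" if "k < 0" for k l
      using that by (simp_all add: G_outside)
    have up: "G p (Suc w) (i + 1) j = (if i + 1 = j then 1 else 0)
      + ?a * (G p (Suc w) (i + 2) j + G p (Suc w) i j)
      + ?b * (G p (Suc w) (i + 3) j + G p (Suc w) (i - 1) j)"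
      using G_rec[OF p, of "i + 1" "Suc w" j] i by (simp add: algebra_simps)
    note low = G_rec[OF p i]
    \<comment> \<open>A step down to level 0 of the larger strip occurs in \<open>up\<close> only
      for \<open>i = 0\<close> (weight \<open>?a\<close>) and \<open>i = 1\<close> (weight
      \<open>?b\<close>). It cancels against the empty walk in \<open>G p w 0 0\<close> or
      \<open>G p w 1 1\<close> respectively.\<close>
    consider "i = 0" | "i = 1" | "i \<ge> 2" using i by force
    then have "f i = ?a * (f (i + 1) + f (i - 1)) + ?b * (f (i + 2) + f (i - 2))"
    proof cases
      case 1
      then show ?thesis
        using up low[of "j - 1"] low[of 0] low[of 1]
        by (auto simp: f_def D_def neg algebra_simps)
    next
      case 2
      then show ?thesis
        using up low[of "j - 1"] low[of 0] low[of 1]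
        by (auto simp: f_def D_def neg algebra_simps)
    next
      case 3
      then show ?thesis
        using up low[of "j - 1"] low[of 0] low[of 1]
        by (auto simp: f_def D_def neg algebra_simps)
    qed
    then show "f i = (\<Sum>s\<in>steps p. zpow (fst s / 2) * f (i + snd s))"
      by (simp add: sum_steps)
  qed
  with i show ?thesis by (simp add: f_def D_def algebra_simps)
qed

section \<open>Relations among the series at levels 0 and 1\<close>

lemma X_Suc:
  assumes p: "p > 0"
  shows "X p (Suc w) = 1 + X p (Suc w) * (zpow (1 / 2) ^ 2 * X p w
    + zpow (1 / 2) * zpow (p / 2) * (G p w 0 1 + G p w 1 0) + zpow (p / 2) ^ 2 * G p w 1 1)"
proof -
  have *: "X p (Suc w) = 1 + zpow (1 / 2) * G p (Suc w) 1 0 + zpow (p / 2) * G p (Suc w) 2 0"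
    using G_rec[OF p, of 0 "Suc w" 0] by (simp add: X_eq_G G_outside)
  show ?thesis
    using G_cut[OF p, of 0 w 0] G_cut[OF p, of 1 w 0]
    by (subst *) (simp add: X_eq_G G_outside algebra_simps power2_eq_square)
qed

lemma G10_Suc:
  assumes "p > 0"
  shows "G p (Suc w) 1 0 = X p (Suc w) * (zpow (1 / 2) * X p w + zpow (p / 2) * G p w 0 1)"
  using G_cut[OF assms, of 0 w 0] by (simp add: X_eq_G G_outside)

lemma G11_Suc:
  assumes "p > 0"
  shows "G p (Suc w) 1 1 = X p w
    + G p (Suc w) 0 1 * (zpow (1 / 2) * X p w + zpow (p / 2) * G p w 0 1)"
  using G_cut[OF assms, of 0 w 1] by (simp add: X_eq_G)

text \<open>Induction on \<open>w\<close> replaces reversal of walks: cutting gives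
  \<open>G p (Suc w) 1 0\<close> directly, while the first-step equation for
  \<open>G p (Suc w) 0 1\<close> is linear with coefficient \<open>u\<close>, whose inverse is
  \<open>x\<close>. Both yield the same product.\<close>

lemma G_sym:
  assumes p: "p > 0"
  shows "G p w 0 1 = G p w 1 0"
proof (induction w)
  case 0
  show ?case by (simp add: G_outside)
next
  case (Suc w)
  define a b x' y' t' x y where defs: "a = zpow (1 / 2)" "b = zpow (p / 2)"
    "x' = X p w" "y' = G p w 0 1" "t' = G p w 1 1" "x = X p (Suc w)" "y = G p (Suc w) 0 1"
  have y: "y = a * (x' + y * (a * x' + b * y')) + b * (y' + y * (a * y' + b * t'))"
    using G_rec[OF p, of 0 "Suc w" 1] G_cut[OF p, of 0 w 1] G_cut[OF p, of 1 w 1] Suc.IH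
    by (simp add: X_eq_G G_outside defs)
  have x: "x = 1 + x * (a ^ 2 * x' + a * b * (y' + y') + b ^ 2 * t')"
    using X_Suc[OF p, of w] Suc.IH by (simp add: defs)
  define u where "u = 1 - (a ^ 2 * x' + a * b * (y' + y') + b ^ 2 * t')"
  have "x * u = 1" using x by (simp add: u_def algebra_simps)
  moreover have "y * u = a * x' + b * y'"
    using y by (simp add: u_def algebra_simps power2_eq_square)
  ultimately have "y = x * (a * x' + b * y')"
    by (metis mult.left_commute mult.right_neutral)
  then show ?case
    using G10_Suc[OF p, of w] Suc.IH by (simp add: defs)
qed

lemma G11_eq_X:
  assumes p: "p > 0"
  shows "G p (Suc (Suc w)) 1 1 =
    X p (Suc (Suc w)) * X p (Suc w) * (1 - zpow (p / 2) ^ 2 * X p w)"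
proof -
  define a b x x' x'' y y' y'' t t' where defs: "a = zpow (1 / 2)" "b = zpow (p / 2)"
    "x = X p (Suc (Suc w))" "x' = X p (Suc w)" "x'' = X p w"
    "y = G p (Suc (Suc w)) 0 1" "y' = G p (Suc w) 0 1" "y'' = G p w 0 1"
    "t = G p (Suc (Suc w)) 1 1" "t' = G p (Suc w) 1 1"
  define u where "u = 1 - (a ^ 2 * x' + a * b * (y' + y') + b ^ 2 * t')"
  define c where "c = a * x' + b * y'"
  have xu: "x * u = 1"
    using X_Suc[OF p, of "Suc w"] G_sym[OF p] by (simp add: defs u_def algebra_simps)
  have y: "y = x * c" "y' = x' * (a * x'' + b * y'')"
    using G10_Suc[OF p] G_sym[OF p] by (simp_all add: defs c_def)
  have t: "t = x' + y * c" "t' = x'' + y' * (a * x'' + b * y'')"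
    using G11_Suc[OF p] by (simp_all add: defs c_def)
  \<comment> \<open>A 2 by 2 minor: \<open>x' * t' - y' ^ 2 = x' * x''\<close>. In
    \<open>t * u\<close> the terms with \<open>a\<close> cancel and exactly this minor remains, so
    \<open>y'\<close> and \<open>t'\<close> disappear together.\<close>
  have t': "x' * t' = x' * x'' + y' ^ 2"
    by (subst (1) t(2)) (simp add: y(2) algebra_simps power2_eq_square)
  have "t * u = x' * u + x * u * c ^ 2"
    by (simp add: t(1) y(1) algebra_simps power2_eq_square)
  also have "\<dots> = x' - b ^ 2 * (x' * t') + b ^ 2 * y' ^ 2"
    by (simp add: xu) (simp add: u_def c_def algebra_simps power2_eq_square)
  also have "\<dots> = x' * (1 - b ^ 2 * x'')"
    unfolding t' by (simp add: algebra_simps)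
  finally have "x * (t * u) = x * (x' * (1 - b ^ 2 * x''))" by simp
  moreover have "x * (t * u) = t" by (metis xu mult.left_commute mult.right_neutral)
  ultimately show ?thesis by (simp add: defs mult.assoc)
qed

section \<open>Elimination of the auxiliary series\<close>

lemma X_recurrence:
  fixes p w
  defines "a \<equiv> zpow (1 / 2)" and "b \<equiv> zpow (p / 2)"
    and "x \<equiv> \<lambda>i. X p (w + i)"
  assumes p: "p > 0"
  shows "x 4 = 1 - b * x 4 + (a ^ 2 + b) * x 4 * x 3 + (a ^ 2 * b + b ^ 2) * x 4 * x 3 * x 2
    - (b ^ 3 + b ^ 4) * x 4 * x 3 * x 2 * x 1 + b ^ 5 * x 4 * x 3 * x 2 * x 1 * x 0"
proof -
  define y where "y i = G p (w + i) 0 1" for i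
  define t where "t i = G p (w + i) 1 1" for i
  have x: "x 4 = 1 + x 4 * (a ^ 2 * x 3 + a * b * (y 3 + y 3) + b ^ 2 * t 3)"
       "x 3 = 1 + x 3 * (a ^ 2 * x 2 + a * b * (y 2 + y 2) + b ^ 2 * t 2)"
    using X_Suc[OF p, of "w + 3"] X_Suc[OF p, of "w + 2"] G_sym[OF p]
    by (simp_all add: a_def b_def x_def y_def t_def eval_nat_numeral)
  have t: "t 3 = x 3 * x 2 * (1 - b ^ 2 * x 1)" "t 2 = x 2 * x 1 * (1 - b ^ 2 * x 0)"
    using G11_eq_X[OF p, of "w + 1"] G11_eq_X[OF p, of w]
    by (simp_all add: b_def x_def t_def eval_nat_numeral)
  have y: "y 3 = x 3 * (a * x 2 + b * y 2)"
    using G10_Suc[OF p, of "w + 2"] G_sym[OF p]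
    by (simp add: a_def b_def x_def y_def eval_nat_numeral)
  have y2: "a * b * x 3 * (y 2 + y 2) =
    x 3 - 1 - a ^ 2 * x 3 * x 2 - b ^ 2 * x 3 * (x 2 * x 1 * (1 - b ^ 2 * x 0))"
    using x(2) by (simp add: t algebra_simps)
  have "x 4 = 1 + a ^ 2 * x 4 * x 3 + (a ^ 2 + a ^ 2) * b * x 4 * x 3 * x 2
    + b * x 4 * (a * b * x 3 * (y 2 + y 2)) + b ^ 2 * x 4 * (x 3 * x 2 * (1 - b ^ 2 * x 1))"
    by (subst x(1)) (simp add: t y algebra_simps power2_eq_square)
  then show ?thesis
    unfolding y2 by (simp add: algebra_simps eval_nat_numeral)
qed

theorem theorem2:
  fixes p :: real and w :: nat
  assumes "p > 0" and "w \<ge> 4"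
  shows "X p w = 1 - zpow (p / 2) * X p w
    + (zpow 1 + zpow (p / 2)) * X p w * X p (w - 1)
    + (zpow (1 + p / 2) + zpow p) * X p w * X p (w - 1) * X p (w - 2)
    - (zpow (3 * p / 2) + zpow (2 * p)) * X p w * X p (w - 1) * X p (w - 2) * X p (w - 3)
    + zpow (5 * p / 2) * X p w * X p (w - 1) * X p (w - 2) * X p (w - 3) * X p (w - 4)"
proof -
  have pow: "zpow c ^ n = zpow (real n * c)" for c n
    by (induction n) (simp_all add: zpow_0 zpow_add algebra_simps)
  have "zpow (1 / 2) ^ 2 = zpow 1" "zpow (p / 2) ^ 2 = zpow p"
    "zpow (1 + p / 2) = zpow 1 * zpow (p / 2)" "zpow (p / 2) ^ 3 = zpow (3 * p / 2)"
    "zpow (p / 2) ^ 4 = zpow (2 * p)" "zpow (p / 2) ^ 5 = zpow (5 * p / 2)"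
    by (simp_all add: pow zpow_add)
  moreover obtain v where "w = v + 4"
    using assms(2) by (metis add.commute le_Suc_ex)
  moreover from this have "w - 1 = v + 3" "w - 2 = v + 2" "w - 3 = v + 1" "w - 4 = v + 0"
    by simp_all
  ultimately show ?thesis
    using X_recurrence[OF assms(1), of v] by (simp only:)
qed

end
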